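(* Let $(X,\mathcal{M})$ be an $m$-complete multi-normed vector lattice (MNVL) with the pre-Lebesgue property. Then $X$ has the Lebesgue and Levi properties if and only if every $m$-bounded $um$-closed subset of $X$ is $um$-complete.
   Context: A multi-normed vector lattice (MNVL) $(X,\mathcal{M})$ is a real vector lattice $X$ together with a separating, upward directed family $\mathcal{M}=\{m_\lambda\}_{\lambda\in\Lambda}$ of lattice seminorms on $X$ (seminorms with $|x|\le|y|\Rightarrow m_\lambda(x)\le m_\lambda(y)$). The $m$-topology is the Hausdorff locally convex-solid topology generated by $\mathcal{M}$; a net $x_\alpha$ $m$-converges to $x$ ($x_\alpha\xrightarrow{m}x$) iff $m_\lambda(x_\alpha-x)\to0$ for every $\lambda\in\Lambda$. $m$-complete, $m$-Cauchy refer to the $m$-topology. A subset $A\subseteq X$ is $m$-bounded if $\sup_{a\in A}m_\lambda(a)<\infty$ for every $\lambda\in\Lambda$. A net $x_\alpha$ in $X$ is $um$-convergent to $x$ if $|x_\alpha-x|\wedge u\xrightarrow{m}0$ for every $u\in X_+$. This is convergence with respect to a Hausdorff locally solid linear topology, the $um$-topology, which has a base of neighborhoods at zero consisting of the sets $\{x\in X: m_\lambda(|x|\wedge u)<\varepsilon\}$, $\varepsilon>0$, $0\ne u\in X_+$, $\lambda\in\Lambda$. A subset is $um$-closed ($um$-complete) if it is closed (complete) in the $um$-topology. $(X,\mathcal{M})$ has the Lebesgue property if $x_\alpha\downarrow0$ (nets) implies $x_\alpha\xrightarrow{m}0$; the pre-Lebesgue property if $0\le x_n\uparrow\le x$ (sequences)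 implies that $x_n$ is $m$-Cauchy; the Levi property if every net with $0\le x_\alpha\uparrow$ that is $m$-bounded satisfies $x_\alpha\uparrow x$ for some $x\in X$. *)

theory Defs
  imports "HOL-Analysis.Analysis" "HOL-Library.Lattice_Algebras" "HOL-Library.Lub_Glb"
begin

section \<open>Multi-normed vector lattices\<close>

class vector_lattice = ordered_real_vector + lattice_ab_group_add_abs

definition lattice_seminorm :: "('a::vector_lattice \<Rightarrow> real) \<Rightarrow> bool" where
  "lattice_seminorm p \<longleftrightarrow>
     (\<forall>x y. p (x + y) \<le> p x + p y) \<and>
     (\<forall>c x. p (c *\<^sub>R x) = \<bar>c\<bar> * p x) \<and>
     (\<forall>x y. \<bar>x\<bar> \<le> \<bar>y\<bar> \<longrightarrow> p x \<le> p y)"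

text \<open>The family of seminorms is given by its set of members; nothing below depends on how it
  is indexed. Directedness includes that the family is nonempty.\<close>

locale multi_normed_vector_lattice =
  fixes M :: "('a::vector_lattice \<Rightarrow> real) set"
  assumes seminorm: "p \<in> M \<Longrightarrow> lattice_seminorm p"
    and nonempty: "M \<noteq> {}"
    and upward_directed: "p \<in> M \<Longrightarrow> q \<in> M \<Longrightarrow> \<exists>r\<in>M. \<forall>x. p x \<le> r x \<and> q x \<le> r x"
    and separating: "x \<noteq> 0 \<Longrightarrow> \<exists>p\<in>M. p x \<noteq> 0"

section \<open>Translation-invariant topologies given by a base of neighbourhoods of zero\<close>

text \<open>\<open>topology\<close> is unspecified unless its argument satisfies \<open>istopology\<close>; see the lemmas
  \<open>openin_m_topology\<close> and \<open>openin_um_topology\<close> below. Cauchy filters and completeness are as for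
  \<open>uniform_space\<close>, relative to the uniformity generated by \<open>{(x, y). x - y \<in> V}\<close>,
  \<open>V \<in> B\<close>.\<close>

definition zero_base_topology :: "'a::ab_group_add set set \<Rightarrow> 'a topology" where
  "zero_base_topology B = topology (\<lambda>U. \<forall>x\<in>U. \<exists>V\<in>B. (\<lambda>v. x + v) ` V \<subseteq> U)"

definition zero_base_cauchy :: "'a::ab_group_add set set \<Rightarrow> 'a filter \<Rightarrow> bool" where
  "zero_base_cauchy B F \<longleftrightarrow> (\<forall>V\<in>B. \<forall>\<^sub>F (x, y) in F \<times>\<^sub>F F. x - y \<in> V)"

definition zero_base_complete :: "'a::ab_group_add set set \<Rightarrow> 'a set \<Rightarrow> bool" where
  "zero_base_complete B A \<longleftrightarrow>
     (\<forall>F \<le> principal A. F \<noteq> bot \<longrightarrow> zero_base_cauchy B F \<longrightarrow>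
        (\<exists>a\<in>A. limitin (zero_base_topology B) (\<lambda>x. x) a F))"

section \<open>The \<open>m\<close>-topology and the \<open>um\<close>-topology\<close>

definition m_base :: "('a::vector_lattice \<Rightarrow> real) set \<Rightarrow> 'a set set" where
  "m_base M = {{x. p x < \<epsilon>} |p \<epsilon>. p \<in> M \<and> \<epsilon> > 0}"

text \<open>Allowing \<open>u = 0\<close> only adds the whole space to the base. This changes nothing in a nonzero
  space and provides a neighbourhood of zero in the zero space.\<close>

definition um_base :: "('a::vector_lattice \<Rightarrow> real) set \<Rightarrow> 'a set set" where
  "um_base M = {{x. p (inf \<bar>x\<bar> u) < \<epsilon>} |p u \<epsilon>. p \<in> M \<and> 0 \<le> u \<and> \<epsilon> > 0}"

definition m_topology :: "('a::vector_lattice \<Rightarrow> real) set \<Rightarrow> 'a topology" where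
  "m_topology M = zero_base_topology (m_base M)"

definition um_topology :: "('a::vector_lattice \<Rightarrow> real) set \<Rightarrow> 'a topology" where
  "um_topology M = zero_base_topology (um_base M)"

definition m_cauchy :: "('a::vector_lattice \<Rightarrow> real) set \<Rightarrow> 'a filter \<Rightarrow> bool" where
  "m_cauchy M F \<longleftrightarrow> zero_base_cauchy (m_base M) F"

definition m_complete :: "('a::vector_lattice \<Rightarrow> real) set \<Rightarrow> bool" where
  "m_complete M \<longleftrightarrow> zero_base_complete (m_base M) UNIV"

definition um_closed :: "('a::vector_lattice \<Rightarrow> real) set \<Rightarrow> 'a set \<Rightarrow> bool" where
  "um_closed M A \<longleftrightarrow> closedin (um_topology M) A"

definition um_complete :: "('a::vector_lattice \<Rightarrow> real) set \<Rightarrow> 'a set \<Rightarrow> bool" where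
  "um_complete M A \<longleftrightarrow> zero_base_complete (um_base M) A"

definition m_bounded :: "('a::vector_lattice \<Rightarrow> real) set \<Rightarrow> 'a set \<Rightarrow> bool" where
  "m_bounded M A \<longleftrightarrow> (\<forall>p\<in>M. bdd_above (p ` A))"

definition m_converges ::
    "('a::vector_lattice \<Rightarrow> real) set \<Rightarrow> ('i \<Rightarrow> 'a) \<Rightarrow> 'a \<Rightarrow> 'i filter \<Rightarrow> bool" where
  "m_converges M f l F \<longleftrightarrow> (\<forall>p\<in>M. ((\<lambda>i. p (f i - l)) \<longlongrightarrow> 0) F)"

definition um_converges ::
    "('a::vector_lattice \<Rightarrow> real) set \<Rightarrow> ('i \<Rightarrow> 'a) \<Rightarrow> 'a \<Rightarrow> 'i filter \<Rightarrow> bool" where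
  "um_converges M f l F \<longleftrightarrow> (\<forall>u\<ge>0. m_converges M (\<lambda>i. inf \<bar>f i - l\<bar> u) 0 F)"

section \<open>Nets and the Lebesgue, pre-Lebesgue and Levi properties\<close>

definition directed_set :: "'i set \<Rightarrow> ('i \<Rightarrow> 'i \<Rightarrow> bool) \<Rightarrow> bool" where
  "directed_set I le \<longleftrightarrow> I \<noteq> {} \<and> reflp_on I le \<and> transp_on I le \<and>
     (\<forall>i\<in>I. \<forall>j\<in>I. \<exists>k\<in>I. le i k \<and> le j k)"

definition net_filter :: "'i set \<Rightarrow> ('i \<Rightarrow> 'i \<Rightarrow> bool) \<Rightarrow> 'i filter" where
  "net_filter I le = (INF i\<in>I. principal {j\<in>I. le i j})"

definition net_decreases_to ::
    "'i set \<Rightarrow> ('i \<Rightarrow> 'i \<Rightarrow> bool) \<Rightarrow> ('i \<Rightarrow> 'a::order) \<Rightarrow> 'a \<Rightarrow> bool" where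
  "net_decreases_to I le x a \<longleftrightarrow> monotone_on I le (\<ge>) x \<and> isGlb UNIV (x ` I) a"

definition net_increases_to ::
    "'i set \<Rightarrow> ('i \<Rightarrow> 'i \<Rightarrow> bool) \<Rightarrow> ('i \<Rightarrow> 'a::order) \<Rightarrow> 'a \<Rightarrow> bool" where
  "net_increases_to I le x a \<longleftrightarrow> monotone_on I le (\<le>) x \<and> isLub UNIV (x ` I) a"

text \<open>A definition cannot quantify over index types. In the two properties of nets the index sets
  are subsets of the space itself (with arbitrary directed preorders); the lemmas
  \<open>lebesgue_property_net\<close> and \<open>levi_property_net\<close> show that this covers nets over every
  index type.\<close>

definition lebesgue_property :: "('a::vector_lattice \<Rightarrow> real) set \<Rightarrow> bool" where
  "lebesgue_property M \<longleftrightarrow>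
     (\<forall>(I :: 'a set) le x. directed_set I le \<longrightarrow> net_decreases_to I le x 0 \<longrightarrow>
        m_converges M x 0 (net_filter I le))"

definition pre_lebesgue_property :: "('a::vector_lattice \<Rightarrow> real) set \<Rightarrow> bool" where
  "pre_lebesgue_property M \<longleftrightarrow>
     (\<forall>(x :: nat \<Rightarrow> 'a) a. incseq x \<longrightarrow> (\<forall>n. 0 \<le> x n \<and> x n \<le> a) \<longrightarrow>
        m_cauchy M (filtermap x sequentially))"

definition levi_property :: "('a::vector_lattice \<Rightarrow> real) set \<Rightarrow> bool" where
  "levi_property M \<longleftrightarrow>
     (\<forall>(I :: 'a set) le x. directed_set I le \<longrightarrow> monotone_on I le (\<le>) x \<longrightarrow>
        (\<forall>i\<in>I. 0 \<le> x i) \<longrightarrow> m_bounded M (x ` I) \<longrightarrow> (\<exists>a. net_increases_to I le x a))"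

section \<open>Adequacy of the definitions\<close>

lemma eventually_net_filter:
  assumes "directed_set I le"
  shows "eventually P (net_filter I le) \<longleftrightarrow> (\<exists>i\<in>I. \<forall>j\<in>I. le i j \<longrightarrow> P j)"
proof -
  have "eventually P (net_filter I le) \<longleftrightarrow>
      (\<exists>i\<in>I. eventually P (principal {j\<in>I. le i j}))"
    unfolding net_filter_def
  proof (rule eventually_INF_base)
    show "I \<noteq> {}" using assms by (simp add: directed_set_def)
    fix i j assume ij: "i \<in> I" "j \<in> I"
    then obtain k where k: "k \<in> I" "le i k" "le j k"
      using assms by (auto simp: directed_set_def)
    have "{l\<in>I. le k l} \<subseteq> {l\<in>I. le i l} \<inter> {l\<in>I. le j l}"
      using assms ij k by (auto simp: directed_set_def dest: transp_onD)
    then show "\<exists>k\<in>I. principal {l\<in>I. le k l} \<le>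
        inf (principal {l\<in>I. le i l}) (principal {l\<in>I. le j l})"
      using k(1) by auto
  qed
  then show ?thesis by (auto simp: eventually_principal)
qed

lemma lattice_seminorm_mono:
  "lattice_seminorm p \<Longrightarrow> \<bar>x\<bar> \<le> \<bar>y\<bar> \<Longrightarrow> p x \<le> p y"
  by (simp add: lattice_seminorm_def)

lemma lattice_seminorm_zero: "lattice_seminorm p \<Longrightarrow> p 0 = 0"
  unfolding lattice_seminorm_def by (metis abs_zero mult_zero_left scaleR_zero_left)

lemma lattice_seminorm_nonneg:
  assumes "lattice_seminorm p"
  shows "0 \<le> p x"
  using lattice_seminorm_mono[OF assms, of 0 x] lattice_seminorm_zero[OF assms] by simp

lemma m_converges_iff:
  assumes "multi_normed_vector_lattice M"
  shows "m_converges M f l F \<longleftrightarrow> (\<forall>p\<in>M. \<forall>\<epsilon>>0. \<forall>\<^sub>F i in F. p (f i - l) < \<epsilon>)"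
proof -
  have "\<bar>p x\<bar> = p x" if "p \<in> M" for p x
    using lattice_seminorm_nonneg[OF multi_normed_vector_lattice.seminorm[OF assms that]]
    by (rule abs_of_nonneg)
  then show ?thesis by (auto simp: m_converges_def tendsto_iff)
qed

locale zero_base =
  fixes B :: "'a::ab_group_add set set"
  assumes base_nonempty: "B \<noteq> {}"
    and zero_in_base: "V \<in> B \<Longrightarrow> 0 \<in> V"
    and base_directed: "V \<in> B \<Longrightarrow> W \<in> B \<Longrightarrow> \<exists>Z\<in>B. Z \<subseteq> V \<inter> W"
    and base_sum: "V \<in> B \<Longrightarrow> \<exists>W\<in>B. \<forall>x\<in>W. \<forall>y\<in>W. x + y \<in> V"
begin

lemma openin_zero_base_topology:
  "openin (zero_base_topology B) U \<longleftrightarrow> (\<forall>x\<in>U. \<exists>V\<in>B. (\<lambda>v. x + v) ` V \<subseteq> U)"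
proof -
  have "istopology (\<lambda>U. \<forall>x\<in>U. \<exists>V\<in>B. (\<lambda>v. x + v) ` V \<subseteq> U)"
    unfolding istopology_def
  proof (intro conjI allI impI ballI)
    fix S T x
    assume S: "\<forall>x\<in>S. \<exists>V\<in>B. (\<lambda>v. x + v) ` V \<subseteq> S"
      and T: "\<forall>x\<in>T. \<exists>V\<in>B. (\<lambda>v. x + v) ` V \<subseteq> T" and x: "x \<in> S \<inter> T"
    obtain V where V: "V \<in> B" "(\<lambda>v. x + v) ` V \<subseteq> S" using S x by blast
    obtain W where W: "W \<in> B" "(\<lambda>v. x + v) ` W \<subseteq> T" using T x by blast
    obtain Z where Z: "Z \<in> B" "Z \<subseteq> V \<inter> W" using base_directed[OF V(1) W(1)] by blast
    have "x + z \<in> S \<inter> T" if "z \<in> Z" for z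
    proof
      have "z \<in> V" "z \<in> W" using that Z(2) by (simp_all add: subset_iff)
      then show "x + z \<in> S" "x + z \<in> T"
        using subsetD[OF V(2) imageI] subsetD[OF W(2) imageI] by simp_all
    qed
    then have "(\<lambda>v. x + v) ` Z \<subseteq> S \<inter> T" by (rule image_subsetI)
    then show "\<exists>V\<in>B. (\<lambda>v. x + v) ` V \<subseteq> S \<inter> T" using Z(1) by blast
  next
    fix K x
    assume K: "\<forall>S\<in>K. \<forall>x\<in>S. \<exists>V\<in>B. (\<lambda>v. x + v) ` V \<subseteq> S" and x: "x \<in> \<Union>K"
    then obtain S where S: "S \<in> K" "x \<in> S" by blast
    then obtain V where V: "V \<in> B" "(\<lambda>v. x + v) ` V \<subseteq> S" using K by blast
    then have "(\<lambda>v. x + v) ` V \<subseteq> \<Union>K" using S(1) by (meson Union_upper order_trans)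
    then show "\<exists>V\<in>B. (\<lambda>v. x + v) ` V \<subseteq> \<Union>K" using V(1) by blast
  qed
  then show ?thesis by (simp add: zero_base_topology_def topology_inverse')
qed

lemma topspace_zero_base_topology: "topspace (zero_base_topology B) = UNIV"
proof -
  have "openin (zero_base_topology B) UNIV"
    using base_nonempty by (auto simp: openin_zero_base_topology)
  then show ?thesis by (metis openin_subset top.extremum_uniqueI)
qed

lemma limitin_zero_base_topology:
  "limitin (zero_base_topology B) f l F \<longleftrightarrow> (\<forall>V\<in>B. \<forall>\<^sub>F i in F. f i - l \<in> V)"
proof
  assume L: "limitin (zero_base_topology B) f l F"
  show "\<forall>V\<in>B. \<forall>\<^sub>F i in F. f i - l \<in> V"
  proof
    fix V assume V: "V \<in> B"
    define U where "U = {x. \<exists>W\<in>B. \<forall>w\<in>W. x + w - l \<in> V}"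
    have "\<exists>W\<in>B. (\<lambda>v. x + v) ` W \<subseteq> U" if x: "x \<in> U" for x
    proof -
      obtain W where W: "W \<in> B" "\<forall>w\<in>W. x + w - l \<in> V" using x by (auto simp: U_def)
      obtain Z where Z: "Z \<in> B" "\<forall>a\<in>Z. \<forall>b\<in>Z. a + b \<in> W" using base_sum[OF W(1)] by blast
      then have "\<forall>a\<in>Z. \<forall>b\<in>Z. x + a + b - l \<in> V" using W(2) by (metis add.assoc)
      then show ?thesis using Z(1) by (auto simp: U_def)
    qed
    then have "openin (zero_base_topology B) U" by (simp add: openin_zero_base_topology)
    moreover have "l \<in> U" using V by (auto simp: U_def)
    ultimately have "\<forall>\<^sub>F i in F. f i \<in> U" using L by (auto simp: limitin_def)
    moreover have "x - l \<in> V" if "x \<in> U" for x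
      using that zero_in_base by (force simp: U_def)
    ultimately show "\<forall>\<^sub>F i in F. f i - l \<in> V" by (auto elim: eventually_mono)
  qed
next
  assume R: "\<forall>V\<in>B. \<forall>\<^sub>F i in F. f i - l \<in> V"
  show "limitin (zero_base_topology B) f l F"
    unfolding limitin_def topspace_zero_base_topology openin_zero_base_topology
  proof (intro conjI allI impI)
    fix U assume U: "(\<forall>x\<in>U. \<exists>V\<in>B. (\<lambda>v. x + v) ` V \<subseteq> U) \<and> l \<in> U"
    then obtain V where V: "V \<in> B" "(\<lambda>v. l + v) ` V \<subseteq> U" by blast
    have "x \<in> U" if "x - l \<in> V" for x
      using V(2) that by (metis add.commute diff_add_cancel image_subset_iff)
    then show "\<forall>\<^sub>F i in F. f i \<in> U" using R V(1) by (blast intro: eventually_mono)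
  qed simp
qed

end

lemma m_baseI: "p \<in> M \<Longrightarrow> 0 < \<epsilon> \<Longrightarrow> {x. p x < \<epsilon>} \<in> m_base M"
  unfolding m_base_def by blast

lemma um_baseI: "p \<in> M \<Longrightarrow> 0 \<le> u \<Longrightarrow> 0 < \<epsilon> \<Longrightarrow> {x. p (inf \<bar>x\<bar> u) < \<epsilon>} \<in> um_base M"
  unfolding um_base_def by blast

lemma ball_m_base: "(\<forall>V\<in>m_base M. P V) \<longleftrightarrow> (\<forall>p\<in>M. \<forall>\<epsilon>>0. P {x. p x < \<epsilon>})"
  unfolding m_base_def by blast

lemma ball_um_base:
  "(\<forall>V\<in>um_base M. P V) \<longleftrightarrow> (\<forall>u\<ge>0. \<forall>p\<in>M. \<forall>\<epsilon>>0. P {x. p (inf \<bar>x\<bar> u) < \<epsilon>})"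
  unfolding um_base_def by blast

lemma inf_add_le:
  fixes a b u :: "'a::vector_lattice"
  assumes "0 \<le> a" "0 \<le> b" "0 \<le> u"
  shows "inf (a + b) u \<le> inf a u + inf b u"
proof -
  have "inf (a + b) u - inf b u \<le> a"
  proof -
    have "inf (a + b) u \<le> inf (a + b) (a + u)"
      using assms by (simp add: le_infI2 add_increasing)
    also have "\<dots> = a + inf b u" by (simp add: add_inf_distrib_left)
    finally show ?thesis by (simp only: diff_le_eq)
  qed
  moreover have "inf (a + b) u - inf b u \<le> u"
  proof -
    have "inf (a + b) u \<le> u + inf b u" using assms by (simp add: le_infI2 add_increasing2)
    then show ?thesis by (simp only: diff_le_eq)
  qed
  ultimately have "inf (a + b) u - inf b u \<le> inf a u" by (rule inf_greatest)
  then show ?thesis by (simp only: diff_le_eq)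
qed

context multi_normed_vector_lattice
begin

lemma m_zero_base: "zero_base (m_base M)"
proof
  show "m_base M \<noteq> {}" using nonempty m_baseI[OF _ zero_less_one] by blast
next
  fix V assume "V \<in> m_base M"
  then show "0 \<in> V" by (auto simp: m_base_def lattice_seminorm_zero seminorm)
next
  fix V W assume "V \<in> m_base M" "W \<in> m_base M"
  then obtain p q \<epsilon> \<delta> where *: "p \<in> M" "q \<in> M" "\<epsilon> > 0" "\<delta> > 0"
    "V = {x. p x < \<epsilon>}" "W = {x. q x < \<delta>}" by (auto simp: m_base_def)
  obtain r where r: "r \<in> M" "\<forall>x. p x \<le> r x \<and> q x \<le> r x" using upward_directed * by blast
  have "{x. r x < min \<epsilon> \<delta>} \<in> m_base M" using r(1) *(3,4) by (intro m_baseI) simp_all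
  moreover have "{x. r x < min \<epsilon> \<delta>} \<subseteq> V \<inter> W"
  proof
    fix x assume "x \<in> {x. r x < min \<epsilon> \<delta>}"
    then show "x \<in> V \<inter> W" using r(2)[rule_format, of x] by (simp add: *(5,6))
  qed
  ultimately show "\<exists>Z\<in>m_base M. Z \<subseteq> V \<inter> W" by blast
next
  fix V assume "V \<in> m_base M"
  then obtain p \<epsilon> where *: "p \<in> M" "\<epsilon> > 0" "V = {x. p x < \<epsilon>}" by (auto simp: m_base_def)
  have "{x. p x < \<epsilon> / 2} \<in> m_base M" using * by (intro m_baseI) simp_all
  moreover have "p (x + y) < \<epsilon>" if "p x < \<epsilon> / 2" "p y < \<epsilon> / 2" for x y
  proof -
    have "p (x + y) \<le> p x + p y" using seminorm[OF *(1)] by (simp add: lattice_seminorm_def)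
    then show ?thesis using that by linarith
  qed
  ultimately show "\<exists>W\<in>m_base M. \<forall>x\<in>W. \<forall>y\<in>W. x + y \<in> V" using *(3) by (intro bexI) simp_all
qed

lemma um_zero_base: "zero_base (um_base M)"
proof
  show "um_base M \<noteq> {}" using nonempty um_baseI[OF _ order_refl zero_less_one] by blast
next
  fix V assume "V \<in> um_base M"
  then show "0 \<in> V" by (auto simp: um_base_def lattice_seminorm_zero seminorm inf_absorb1)
next
  fix V W assume "V \<in> um_base M" "W \<in> um_base M"
  then obtain p q u v \<epsilon> \<delta> where *: "p \<in> M" "q \<in> M" "\<epsilon> > 0" "\<delta> > 0" "0 \<le> u" "0 \<le> v"
    "V = {x. p (inf \<bar>x\<bar> u) < \<epsilon>}" "W = {x. q (inf \<bar>x\<bar> v) < \<delta>}"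
    unfolding um_base_def by blast
  obtain r where r: "r \<in> M" "\<forall>x. p x \<le> r x \<and> q x \<le> r x" using upward_directed * by blast
  let ?w = "sup u v"
  have "{x. r (inf \<bar>x\<bar> ?w) < min \<epsilon> \<delta>} \<in> um_base M"
    using r(1) *(3-6) by (intro um_baseI) (simp_all add: le_supI1)
  moreover have "p (inf \<bar>x\<bar> u) \<le> r (inf \<bar>x\<bar> ?w)" for x
  proof -
    have "\<bar>inf \<bar>x\<bar> u\<bar> \<le> \<bar>inf \<bar>x\<bar> ?w\<bar>"
      using *(5,6) inf_mono[of "\<bar>x\<bar>" "\<bar>x\<bar>"] by (simp add: abs_of_nonneg le_supI1)
    then show ?thesis
      using lattice_seminorm_mono[OF seminorm[OF *(1)]] r(2)[rule_format, of "inf \<bar>x\<bar> ?w"]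
      by (force intro: order_trans)
  qed
  moreover have "q (inf \<bar>x\<bar> v) \<le> r (inf \<bar>x\<bar> ?w)" for x
  proof -
    have "\<bar>inf \<bar>x\<bar> v\<bar> \<le> \<bar>inf \<bar>x\<bar> ?w\<bar>"
      using *(5,6) inf_mono[of "\<bar>x\<bar>" "\<bar>x\<bar>"] by (simp add: abs_of_nonneg le_supI1)
    then show ?thesis
      using lattice_seminorm_mono[OF seminorm[OF *(2)]] r(2)[rule_format, of "inf \<bar>x\<bar> ?w"]
      by (force intro: order_trans)
  qed
  ultimately show "\<exists>Z\<in>um_base M. Z \<subseteq> V \<inter> W"
    unfolding *(7,8)
    by (intro bexI[of _ "{x. r (inf \<bar>x\<bar> ?w) < min \<epsilon> \<delta>}"]) (auto intro: le_less_trans)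
next
  fix V assume "V \<in> um_base M"
  then obtain p u \<epsilon> where *: "p \<in> M" "0 \<le> u" "\<epsilon> > 0" "V = {x. p (inf \<bar>x\<bar> u) < \<epsilon>}"
    unfolding um_base_def by blast
  have "{x. p (inf \<bar>x\<bar> u) < \<epsilon> / 2} \<in> um_base M"
    using *(1-3) by (intro um_baseI) simp_all
  moreover have "p (inf \<bar>x + y\<bar> u) < \<epsilon>"
    if "p (inf \<bar>x\<bar> u) < \<epsilon> / 2" "p (inf \<bar>y\<bar> u) < \<epsilon> / 2" for x y
  proof -
    have "inf \<bar>x + y\<bar> u \<le> inf (\<bar>x\<bar> + \<bar>y\<bar>) u" by (rule inf_mono) (simp_all add: abs_triangle_ineq)
    also have "\<dots> \<le> inf \<bar>x\<bar> u + inf \<bar>y\<bar> u" by (rule inf_add_le) (simp_all add: *(2))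
    finally have "\<bar>inf \<bar>x + y\<bar> u\<bar> \<le> \<bar>inf \<bar>x\<bar> u + inf \<bar>y\<bar> u\<bar>"
      using *(2) by (simp add: abs_of_nonneg)
    then have "p (inf \<bar>x + y\<bar> u) \<le> p (inf \<bar>x\<bar> u + inf \<bar>y\<bar> u)"
      by (rule lattice_seminorm_mono[OF seminorm[OF *(1)]])
    also have "\<dots> \<le> p (inf \<bar>x\<bar> u) + p (inf \<bar>y\<bar> u)"
      using seminorm[OF *(1)] by (simp add: lattice_seminorm_def)
    finally show ?thesis using that by linarith
  qed
  ultimately show "\<exists>W\<in>um_base M. \<forall>x\<in>W. \<forall>y\<in>W. x + y \<in> V" unfolding *(4) by (intro bexI) simp_all
qed

lemma openin_m_topology:
  "openin (m_topology M) U \<longleftrightarrow> (\<forall>x\<in>U. \<exists>V\<in>m_base M. (\<lambda>v. x + v) ` V \<subseteq> U)"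
  unfolding m_topology_def by (rule zero_base.openin_zero_base_topology[OF m_zero_base])

lemma openin_um_topology:
  "openin (um_topology M) U \<longleftrightarrow> (\<forall>x\<in>U. \<exists>V\<in>um_base M. (\<lambda>v. x + v) ` V \<subseteq> U)"
  unfolding um_topology_def by (rule zero_base.openin_zero_base_topology[OF um_zero_base])

lemma limitin_m_topology: "limitin (m_topology M) f l F \<longleftrightarrow> m_converges M f l F"
  unfolding m_topology_def zero_base.limitin_zero_base_topology[OF m_zero_base]
    m_converges_iff[OF multi_normed_vector_lattice_axioms]
  by (simp add: ball_m_base)

lemma limitin_um_topology: "limitin (um_topology M) f l F \<longleftrightarrow> um_converges M f l F"
  unfolding um_topology_def zero_base.limitin_zero_base_topology[OF um_zero_base]
    um_converges_def m_converges_iff[OF multi_normed_vector_lattice_axioms]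
  by (simp add: ball_um_base)

lemma lebesgue_property_net:
  fixes I :: "'i set"
  assumes L: "lebesgue_property M" and I: "directed_set I le" and x: "net_decreases_to I le x 0"
  shows "m_converges M x 0 (net_filter I le)"
proof -
  have mono: "x j \<le> x i" if "i \<in> I" "j \<in> I" "le i j" for i j
    using x that by (auto simp: net_decreases_to_def monotone_on_def)
  have glb: "isGlb UNIV (x ` I) 0" using x by (simp add: net_decreases_to_def)
  then have nonneg: "0 \<le> x i" if "i \<in> I" for i
    using that by (auto simp: isGlb_def greatestP_def isLb_def setge_def)
  have D: "directed_set (x ` I) (\<ge>)"
    unfolding directed_set_def
  proof (intro conjI ballI)
    show "x ` I \<noteq> {}" using I by (simp add: directed_set_def)
    show "reflp_on (x ` I) (\<ge>)" "transp_on (x ` I) (\<ge>)"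
      by (auto intro!: reflp_onI transp_onI)
    fix a b assume "a \<in> x ` I" "b \<in> x ` I"
    then obtain i j where ij: "i \<in> I" "j \<in> I" "a = x i" "b = x j" by blast
    then obtain k where "k \<in> I" "le i k" "le j k" using I by (auto simp: directed_set_def)
    then show "\<exists>c\<in>x ` I. c \<le> a \<and> c \<le> b" using ij mono by blast
  qed
  have "net_decreases_to (x ` I) (\<ge>) (\<lambda>a. a) 0"
    using glb by (simp add: net_decreases_to_def monotone_on_def)
  then have C: "m_converges M (\<lambda>a. a) 0 (net_filter (x ` I) (\<ge>))"
    using L D unfolding lebesgue_property_def by blast
  show ?thesis
    unfolding m_converges_iff[OF multi_normed_vector_lattice_axioms] eventually_net_filter[OF I]
  proof (intro ballI allI impI)
    fix p and \<epsilon> :: real assume p: "p \<in> M" "0 < \<epsilon>"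
    then obtain i where i: "i \<in> I" "p (x i) < \<epsilon>"
      using C unfolding m_converges_iff[OF multi_normed_vector_lattice_axioms]
        eventually_net_filter[OF D] by fastforce
    have "p (x j - 0) < \<epsilon>" if "j \<in> I" "le i j" for j
      using lattice_seminorm_mono[OF seminorm[OF p(1)], of "x j" "x i"] i mono nonneg that
      by (force simp: abs_of_nonneg)
    then show "\<exists>i\<in>I. \<forall>j\<in>I. le i j \<longrightarrow> p (x j - 0) < \<epsilon>" using i(1) by blast
  qed
qed

end

lemma levi_property_net:
  fixes I :: "'i set"
  assumes L: "levi_property M" and I: "directed_set I le" and x: "monotone_on I le (\<le>) x"
    and nonneg: "\<forall>i\<in>I. 0 \<le> x i" and bdd: "m_bounded M (x ` I)"
  shows "\<exists>a. net_increases_to I le x a"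
proof -
  have D: "directed_set (x ` I) (\<le>)"
    unfolding directed_set_def
  proof (intro conjI ballI)
    show "x ` I \<noteq> {}" using I by (simp add: directed_set_def)
    show "reflp_on (x ` I) (\<le>)" "transp_on (x ` I) (\<le>)"
      by (auto intro!: reflp_onI transp_onI)
    fix a b assume "a \<in> x ` I" "b \<in> x ` I"
    then obtain i j where ij: "i \<in> I" "j \<in> I" "a = x i" "b = x j" by blast
    then obtain k where "k \<in> I" "le i k" "le j k" using I by (auto simp: directed_set_def)
    then show "\<exists>c\<in>x ` I. a \<le> c \<and> b \<le> c" using ij x by (auto simp: monotone_on_def)
  qed
  have "\<exists>a. net_increases_to (x ` I) (\<le>) (\<lambda>a. a) a"
    using L D nonneg bdd unfolding levi_property_def by (simp add: monotone_on_def)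
  then show ?thesis using x by (simp add: net_increases_to_def)
qed

end

theory Submission
  imports Defs
begin

text \<open>The Lebesgue property is automatic: by the pre-Lebesgue property a net decreasing to zero is
  \<open>m\<close>-Cauchy, and its \<open>m\<close>-limit is its infimum.

  If bounded \<open>um\<close>-closed sets are \<open>um\<close>-complete, let \<open>x\<close> be a positive increasing bounded net.
  The truncations of \<open>x\<close> by \<open>k u\<close> are \<open>m\<close>-Cauchy by the pre-Lebesgue property, and
  \<open>inf (y - x) u \<le> inf y (k u) - inf x (k u) + x / k\<close>, so boundedness makes \<open>x\<close> a
  \<open>um\<close>-Cauchy net. It lives in an intersection of seminorm balls, which is
  \<open>um\<close>-closed, and its limit is its supremum.

  Conversely, for a bounded \<open>um\<close>-Cauchy filter the truncations of the positive parts by \<open>u\<close> have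
  \<open>m\<close>-limits \<open>L u\<close>; the Levi property yields \<open>l = sup L\<close>, continuity of truncation
  gives \<open>inf l u = L u\<close>, and \<open>inf \<bar>x - l\<bar> u \<le> \<bar>inf x (l + u) - l\<bar>\<close> shows that \<open>l\<close> is the
  \<open>um\<close>-limit. Negative parts are treated in the same way.\<close>

section \<open>Lattice inequalities for truncations\<close>

text \<open>Adding \<open>inf x (k *\<^sub>R u)\<close> to the left-hand side gives an element below
  both \<open>y + (1 / k) *\<^sub>R x\<close> and
  \<open>k *\<^sub>R u + (1 / k) *\<^sub>R x\<close>, hence below their meet. The error term is
  small for large \<open>k\<close> uniformly on bounded sets, while the truncations are order
  bounded.\<close>

lemma inf_diff_le_truncation:
  fixes x y u :: "'a::vector_lattice"
  assumes x: "0 \<le> x" and k: "1 \<le> (k::real)"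
  shows "inf (y - x) u \<le> (inf y (k *\<^sub>R u) - inf x (k *\<^sub>R u)) + (1 / k) *\<^sub>R x"
proof -
  let ?t = "inf (y - x) u"
  have pos: "0 \<le> (1 / k) *\<^sub>R x" using x k by (simp add: scaleR_nonneg_nonneg)
  have "?t + inf x (k *\<^sub>R u) \<le> (y - x) + x" by (intro add_mono inf_le1)
  also have "\<dots> \<le> y + (1 / k) *\<^sub>R x" using pos by simp
  finally have 1: "?t + inf x (k *\<^sub>R u) \<le> y + (1 / k) *\<^sub>R x" .
  \<comment> \<open>A meet lies below every convex combination of its arguments.\<close>
  have "inf x (k *\<^sub>R u) = (1 / k) *\<^sub>R inf x (k *\<^sub>R u) + (1 - 1 / k) *\<^sub>R inf x (k *\<^sub>R u)"
    by (simp flip: scaleR_add_left)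
  also have "\<dots> \<le> (1 / k) *\<^sub>R x + (1 - 1 / k) *\<^sub>R (k *\<^sub>R u)"
    using k by (intro add_mono scaleR_left_mono) simp_all
  also have "\<dots> = (1 / k) *\<^sub>R x + (k *\<^sub>R u - u)"
    using k by (simp add: scaleR_diff_left algebra_simps)
  finally have "?t + inf x (k *\<^sub>R u) \<le> u + ((1 / k) *\<^sub>R x + (k *\<^sub>R u - u))"
    by (intro add_mono inf_le2)
  then have 2: "?t + inf x (k *\<^sub>R u) \<le> k *\<^sub>R u + (1 / k) *\<^sub>R x" by (simp add: algebra_simps)
  have "?t + inf x (k *\<^sub>R u) \<le> inf y (k *\<^sub>R u) + (1 / k) *\<^sub>R x"
    using 1 2 by (simp add: add_inf_distrib_right)
  then show ?thesis by (simp only: diff_add_eq le_diff_eq)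
qed

text \<open>From \<open>x \<le> pprt y + \<bar>x - y\<bar>\<close>, truncation moves by at most
  \<open>\<bar>x - y\<bar>\<close>; it moves by at most \<open>u\<close> because both truncations
  lie between 0 and \<open>u\<close>. Thus truncating positive parts turns a
  \<open>um\<close>-Cauchy condition into an \<open>m\<close>-Cauchy one.\<close>

lemma abs_inf_pprt_diff_le:
  fixes x y u :: "'a::vector_lattice"
  assumes u: "0 \<le> u"
  shows "\<bar>inf (pprt x) u - inf (pprt y) u\<bar> \<le> inf \<bar>x - y\<bar> u"
proof -
  have *: "inf (pprt x) u - inf (pprt y) u \<le> inf \<bar>x - y\<bar> u" for x y
  proof (rule inf_greatest)
    have "x = y + (x - y)" by simp
    also have "\<dots> \<le> pprt y + \<bar>x - y\<bar>" by (intro add_mono abs_ge_self) (simp add: pprt_def)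
    finally have "x \<le> pprt y + \<bar>x - y\<bar>" .
    then have "pprt x \<le> pprt y + \<bar>x - y\<bar>" by (subst (1) pprt_def) simp
    then have "inf (pprt x) u \<le> inf (pprt y + \<bar>x - y\<bar>) (u + \<bar>x - y\<bar>)"
      by (intro inf_mono) simp_all
    also have "\<dots> = \<bar>x - y\<bar> + inf (pprt y) u"
      by (simp only: add_inf_distrib_left add.commute)
    finally show "inf (pprt x) u - inf (pprt y) u \<le> \<bar>x - y\<bar>" by (simp only: diff_le_eq)
    have "inf (pprt x) u \<le> u + inf (pprt y) u" using u by (simp add: le_infI2)
    then show "inf (pprt x) u - inf (pprt y) u \<le> u" by (simp only: diff_le_eq)
  qed
  show ?thesis
  proof (rule abs_leI)
    show "- (inf (pprt x) u - inf (pprt y) u) \<le> inf \<bar>x - y\<bar> u"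
      using *[of y x] by (simp only: minus_diff_eq abs_minus_commute)
  qed (rule *)
qed

text \<open>Since \<open>\<bar>z\<bar>\<close> is the join of \<open>z\<close> and
  \<open>- z\<close>, it suffices to bound \<open>a + inf \<bar>z\<bar> u\<close> for these two
  values of \<open>a\<close> and then cancel \<open>\<bar>z\<bar>\<close>. With \<open>z\<close> a
  difference \<open>x - l\<close>, this controls the \<open>um\<close>-distance to \<open>l\<close>
  by the \<open>m\<close>-distance of a truncation of \<open>x\<close> at
  \<open>l + u\<close>.\<close>

lemma inf_abs_le_abs_inf:
  fixes z u :: "'a::vector_lattice"
  shows "inf \<bar>z\<bar> u \<le> \<bar>inf z u\<bar>"
proof -
  have *: "a + inf \<bar>z\<bar> u \<le> \<bar>z\<bar> + \<bar>inf z u\<bar>" if "a \<le> \<bar>z\<bar>" "inf a u \<le> \<bar>inf z u\<bar>" for a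
  proof -
    have "a + inf \<bar>z\<bar> u \<le> a + \<bar>z\<bar>" "a + inf \<bar>z\<bar> u \<le> \<bar>z\<bar> + u"
      using that(1) by (intro add_mono; simp)+
    then have "a + inf \<bar>z\<bar> u \<le> inf (\<bar>z\<bar> + a) (\<bar>z\<bar> + u)" by (simp add: add.commute)
    also have "\<dots> = \<bar>z\<bar> + inf a u" by (simp only: add_inf_distrib_left)
    finally show ?thesis using that(2) by (meson add_left_mono order_trans)
  qed
  have "inf (- z) u \<le> - z" by simp
  also have "\<dots> \<le> - inf z u" by (subst neg_le_iff_le) simp
  also have "\<dots> \<le> \<bar>inf z u\<bar>" by (rule abs_ge_minus_self)
  finally have "- z + inf \<bar>z\<bar> u \<le> \<bar>z\<bar> + \<bar>inf z u\<bar>" by (intro *) (simp_all add: abs_ge_minus_self)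
  moreover have "z + inf \<bar>z\<bar> u \<le> \<bar>z\<bar> + \<bar>inf z u\<bar>" by (intro *) (simp_all add: abs_ge_self)
  ultimately have "sup z (- z) + inf \<bar>z\<bar> u \<le> \<bar>z\<bar> + \<bar>inf z u\<bar>"
    by (simp only: add_sup_distrib_right sup_least)
  then show ?thesis by (simp flip: abs_lattice)
qed

lemma inf_abs_triangle:
  fixes x y u :: "'a::vector_lattice"
  assumes "0 \<le> u"
  shows "inf \<bar>x + y\<bar> u \<le> inf \<bar>x\<bar> u + inf \<bar>y\<bar> u"
proof -
  have "inf \<bar>x + y\<bar> u \<le> inf (\<bar>x\<bar> + \<bar>y\<bar>) u" by (rule inf_mono) (simp_all add: abs_triangle_ineq)
  also have "\<dots> \<le> inf \<bar>x\<bar> u + inf \<bar>y\<bar> u" by (rule inf_add_le) (simp_all add: assms)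
  finally show ?thesis .
qed

section \<open>Seminorms, \<open>um\<close>-limits and order\<close>

lemma zero_base_cauchy_um_iff:
  "zero_base_cauchy (um_base M) F \<longleftrightarrow>
    (\<forall>u\<ge>0. \<forall>p\<in>M. \<forall>\<epsilon>>0. \<forall>\<^sub>F (x, y) in F \<times>\<^sub>F F. p (inf \<bar>x - y\<bar> u) < \<epsilon>)"
  unfolding zero_base_cauchy_def ball_um_base by simp

lemma zero_base_cauchy_m_iff:
  "zero_base_cauchy (m_base M) F \<longleftrightarrow>
    (\<forall>p\<in>M. \<forall>\<epsilon>>0. \<forall>\<^sub>F (x, y) in F \<times>\<^sub>F F. p (x - y) < \<epsilon>)"
  unfolding zero_base_cauchy_def ball_m_base by simp

context multi_normed_vector_lattice
begin

lemma triangle: "p \<in> M \<Longrightarrow> p (x + y) \<le> p x + p y"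
  using seminorm by (simp add: lattice_seminorm_def)

lemma scale: "p \<in> M \<Longrightarrow> p (c *\<^sub>R x) = \<bar>c\<bar> * p x"
  using seminorm by (simp add: lattice_seminorm_def)

lemma mono: "p \<in> M \<Longrightarrow> 0 \<le> x \<Longrightarrow> x \<le> \<bar>y\<bar> \<Longrightarrow> p x \<le> p y"
  using lattice_seminorm_mono[OF seminorm] by (simp add: abs_of_nonneg)

lemma abs_eq: "p \<in> M \<Longrightarrow> p \<bar>x\<bar> = p x"
  by (simp add: antisym lattice_seminorm_mono[OF seminorm])

lemma eq_0I:
  assumes "\<And>p \<epsilon>. p \<in> M \<Longrightarrow> 0 < \<epsilon> \<Longrightarrow> p x < \<epsilon>"
  shows "x = 0"
proof (rule ccontr)
  assume "x \<noteq> 0"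
  then obtain p where p: "p \<in> M" "p x \<noteq> 0" using separating by blast
  then have "0 < p x" using lattice_seminorm_nonneg[OF seminorm[OF p(1)], of x] by simp
  then show False using assms[OF p(1), of "p x"] by simp
qed

lemma um_converges_iff:
  "um_converges M f l F \<longleftrightarrow>
    (\<forall>u\<ge>0. \<forall>p\<in>M. \<forall>\<epsilon>>0. \<forall>\<^sub>F i in F. p (inf \<bar>f i - l\<bar> u) < \<epsilon>)"
  unfolding um_converges_def m_converges_iff[OF multi_normed_vector_lattice_axioms] by simp

lemma m_converges_imp_um_converges:
  assumes "m_converges M f l F"
  shows "um_converges M f l F"
  unfolding um_converges_iff
proof (intro allI impI ballI)
  fix u :: 'a and p and \<epsilon> :: real assume *: "0 \<le> u" "p \<in> M" "0 < \<epsilon>"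
  then have "\<forall>\<^sub>F i in F. p (f i - l) < \<epsilon>"
    using assms by (simp add: m_converges_iff[OF multi_normed_vector_lattice_axioms])
  then show "\<forall>\<^sub>F i in F. p (inf \<bar>f i - l\<bar> u) < \<epsilon>"
  proof eventually_elim
    case (elim i)
    have "p (inf \<bar>f i - l\<bar> u) \<le> p (f i - l)" using * by (intro mono) simp_all
    then show ?case using elim by simp
  qed
qed

lemma um_converges_diff:
  assumes f: "um_converges M f l F" and g: "um_converges M g m F"
  shows "um_converges M (\<lambda>i. f i - g i) (l - m) F"
  unfolding um_converges_iff
proof (intro allI impI ballI)
  fix u :: 'a and p and \<epsilon> :: real assume *: "0 \<le> u" "p \<in> M" "0 < \<epsilon>"
  then have "\<forall>\<^sub>F i in F. p (inf \<bar>f i - l\<bar> u) < \<epsilon> / 2" "\<forall>\<^sub>F i in F. p (inf \<bar>g i - m\<bar> u) < \<epsilon> / 2"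
    using f g half_gt_zero[OF *(3)] by (simp_all only: um_converges_iff)
  then show "\<forall>\<^sub>F i in F. p (inf \<bar>f i - g i - (l - m)\<bar> u) < \<epsilon>"
  proof eventually_elim
    case (elim i)
    have "inf \<bar>f i - g i - (l - m)\<bar> u = inf \<bar>(f i - l) + (m - g i)\<bar> u" by (simp add: algebra_simps)
    also have "\<dots> \<le> inf \<bar>f i - l\<bar> u + inf \<bar>m - g i\<bar> u" by (rule inf_abs_triangle[OF *(1)])
    finally have "p (inf \<bar>f i - g i - (l - m)\<bar> u) \<le> p (inf \<bar>f i - l\<bar> u + inf \<bar>m - g i\<bar> u)"
      using * by (intro mono) (auto intro: order_trans[OF _ abs_ge_self])
    also have "\<dots> \<le> p (inf \<bar>f i - l\<bar> u) + p (inf \<bar>g i - m\<bar> u)"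
      using triangle[OF *(2)] by (subst (2) abs_minus_commute)
    finally show ?case using elim by simp
  qed
qed

text \<open>Truncating the distance at \<open>pprt z\<close> itself gives eventually the constant
  \<open>pprt z\<close>, all of whose seminorms must then vanish. This is why order bounds pass to
  \<open>um\<close>-limits.\<close>

lemma nonpos_if_le_um_null:
  assumes lim: "um_converges M f l F" "F \<noteq> bot" and le: "\<forall>\<^sub>F i in F. z \<le> \<bar>f i - l\<bar>"
  shows "z \<le> 0"
proof -
  have "pprt z = 0"
  proof (rule eq_0I)
    fix p and \<epsilon> :: real assume p: "p \<in> M" "0 < \<epsilon>"
    have "\<forall>\<^sub>F i in F. p (inf \<bar>f i - l\<bar> (pprt z)) < \<epsilon>"
      using lim(1) p by (simp add: um_converges_iff)
    then have "\<forall>\<^sub>F i in F. p (pprt z) < \<epsilon>" using le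
    proof eventually_elim
      case (elim i)
      have "pprt z \<le> \<bar>f i - l\<bar>" using elim by (subst pprt_def) simp
      then show ?case using elim by (simp add: inf_absorb2)
    qed
    then show "p (pprt z) < \<epsilon>" using lim(2) by (simp add: eventually_const)
  qed
  then show ?thesis by (simp add: le_zero_iff_zero_pprt)
qed

lemma um_limit_le:
  assumes "um_converges M f l F" "F \<noteq> bot" "\<forall>\<^sub>F i in F. f i \<le> b"
  shows "l \<le> b"
proof -
  have "\<forall>\<^sub>F i in F. l - b \<le> \<bar>f i - l\<bar>"
    using assms(3)
  proof eventually_elim
    case (elim i)
    have "l - b \<le> - (f i - l)" using elim by simp
    then show ?case using abs_ge_minus_self order_trans by blast
  qed
  then show ?thesis using nonpos_if_le_um_null[OF assms(1,2)] by fastforce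
qed

lemma um_limit_ge:
  assumes "um_converges M f l F" "F \<noteq> bot" "\<forall>\<^sub>F i in F. b \<le> f i"
  shows "b \<le> l"
proof -
  have "\<forall>\<^sub>F i in F. b - l \<le> \<bar>f i - l\<bar>"
    using assms(3)
  proof eventually_elim
    case (elim i)
    have "b - l \<le> f i - l" using elim by simp
    then show ?case using abs_ge_self order_trans by blast
  qed
  then show ?thesis using nonpos_if_le_um_null[OF assms(1,2)] by fastforce
qed

lemma um_limit_unique:
  assumes "um_converges M f l F" "um_converges M f m F" "F \<noteq> bot"
  shows "l = m"
proof -
  have *: "um_converges M (\<lambda>i. f i - f i) (l - m) F" by (rule um_converges_diff[OF assms(1,2)])
  have "l - m \<le> 0" by (rule um_limit_le[OF * assms(3)]) simp
  moreover have "0 \<le> l - m" by (rule um_limit_ge[OF * assms(3)]) simp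
  ultimately show ?thesis by simp
qed

lemma m_converges_inf_pprt:
  assumes f: "m_converges M f l F" and u: "0 \<le> u"
  shows "m_converges M (\<lambda>i. inf (pprt (f i)) u) (inf (pprt l) u) F"
  unfolding m_converges_iff[OF multi_normed_vector_lattice_axioms]
proof (intro ballI allI impI)
  fix p and \<epsilon> :: real assume p: "p \<in> M" "0 < \<epsilon>"
  then have "\<forall>\<^sub>F i in F. p (f i - l) < \<epsilon>"
    using f by (simp add: m_converges_iff[OF multi_normed_vector_lattice_axioms])
  then show "\<forall>\<^sub>F i in F. p (inf (pprt (f i)) u - inf (pprt l) u) < \<epsilon>"
  proof eventually_elim
    case (elim i)
    have "\<bar>inf (pprt (f i)) u - inf (pprt l) u\<bar> \<le> \<bar>f i - l\<bar>"
      using abs_inf_pprt_diff_le[OF u, of "f i" l] by simp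
    then show ?case using lattice_seminorm_mono[OF seminorm[OF p(1)]] elim by fastforce
  qed
qed

section \<open>Completeness and the Lebesgue property\<close>

text \<open>Completeness speaks of filters on the space. Pushing \<open>F\<close> forward along
  \<open>f\<close> makes it available for nets and for functions of a filtered variable.\<close>

lemma m_complete_limit:
  assumes "m_complete M" "F \<noteq> bot"
    and "\<And>p \<epsilon>. p \<in> M \<Longrightarrow> 0 < \<epsilon> \<Longrightarrow> \<forall>\<^sub>F (i, j) in F \<times>\<^sub>F F. p (f i - f j) < \<epsilon>"
  shows "\<exists>l. m_converges M f l F"
proof -
  have "zero_base_cauchy (m_base M) (filtermap f F)"
    unfolding zero_base_cauchy_m_iff prod_filtermap1 prod_filtermap2 using assms(3)
    by (simp add: eventually_filtermap case_prod_unfold)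
  moreover have "filtermap f F \<noteq> bot" using assms(2) by (simp add: filtermap_bot_iff)
  ultimately obtain l where "limitin (m_topology M) (\<lambda>x. x) l (filtermap f F)"
    using assms(1) by (auto simp: m_complete_def zero_base_complete_def m_topology_def)
  then have "m_converges M (\<lambda>x. x) l (filtermap f F)" by (simp add: limitin_m_topology)
  then show ?thesis
    by (auto simp: m_converges_iff[OF multi_normed_vector_lattice_axioms] eventually_filtermap)
qed

text \<open>Otherwise every element of \<open>D\<close> has a larger one at
  \<open>p\<close>-distance at least \<epsilon>, and dependent choice builds an increasing order
  bounded sequence that is not Cauchy. This carries the sequential property over to nets.\<close>

lemma pre_lebesgue_set:
  assumes pre: "pre_lebesgue_property M" and D: "D \<noteq> {}" "\<And>d. d \<in> D \<Longrightarrow> 0 \<le> d \<and> d \<le> a"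
    and p: "p \<in> M" "0 < \<epsilon>"
  shows "\<exists>d\<in>D. \<forall>e\<in>D. d \<le> e \<longrightarrow> p (e - d) < \<epsilon>"
proof (rule ccontr)
  assume "\<not> ?thesis"
  then have step: "\<exists>e. e \<in> D \<and> d \<le> e \<and> \<epsilon> \<le> p (e - d)" if "d \<in> D" for d
    using that by (auto simp: not_less)
  obtain d0 where "d0 \<in> D" using D(1) by blast
  then obtain x where x: "\<And>n. x n \<in> D"
    "\<And>n. x n \<le> x (Suc n) \<and> \<epsilon> \<le> p (x (Suc n) - x n)"
    using dependent_nat_choice[of "\<lambda>_ d. d \<in> D" "\<lambda>_ d e. d \<le> e \<and> \<epsilon> \<le> p (e - d)"] step by metis
  have "incseq x" using x(2) by (simp add: incseq_SucI)
  then have "m_cauchy M (filtermap x sequentially)"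
    using pre x(1) D(2) unfolding pre_lebesgue_property_def by blast
  then have "\<forall>\<^sub>F (a, b) in filtermap x sequentially \<times>\<^sub>F filtermap x sequentially. p (a - b) < \<epsilon>"
    using p by (simp add: m_cauchy_def zero_base_cauchy_m_iff)
  then obtain Q where Q: "eventually Q (filtermap x sequentially)"
    "\<And>a b. Q a \<Longrightarrow> Q b \<Longrightarrow> p (a - b) < \<epsilon>"
    unfolding eventually_prod_same by auto
  then obtain N where "\<And>n. n \<ge> N \<Longrightarrow> Q (x n)"
    by (auto simp: eventually_filtermap eventually_sequentially)
  then have "p (x (Suc N) - x N) < \<epsilon>" by (intro Q(2)) simp_all
  then show False using x(2)[of N] by simp
qed

lemma net_filter_neq_bot:
  assumes "directed_set I le"
  shows "net_filter I le \<noteq> bot"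
proof
  assume "net_filter I le = bot"
  then have "eventually (\<lambda>_. False) (net_filter I le)" by simp
  then obtain i where "i \<in> I" "\<forall>j\<in>I. \<not> le i j" by (auto simp: eventually_net_filter[OF assms])
  then show False using assms by (auto simp: directed_set_def dest: reflp_onD)
qed

lemma m_complete_pre_lebesgue_imp_lebesgue:
  assumes "m_complete M" "pre_lebesgue_property M"
  shows "lebesgue_property M"
  unfolding lebesgue_property_def
proof (intro allI impI)
  fix I :: "'a set" and le and x :: "'a \<Rightarrow> 'a"
  assume I: "directed_set I le" and x: "net_decreases_to I le x 0"
  let ?F = "net_filter I le"
  have dec: "x j \<le> x i" if "i \<in> I" "j \<in> I" "le i j" for i j
    using x that by (auto simp: net_decreases_to_def monotone_on_def)
  have glb: "isGlb UNIV (x ` I) 0" using x by (simp add: net_decreases_to_def)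
  then have nonneg: "0 \<le> x i" if "i \<in> I" for i
    using that by (auto simp: isGlb_def greatestP_def isLb_def setge_def)
  have greatest: "b \<le> 0" if "\<And>i. i \<in> I \<Longrightarrow> b \<le> x i" for b
    using glb that by (auto simp: isGlb_def greatestP_def isLb_def setge_def setle_def)
  obtain i0 where i0: "i0 \<in> I" using I by (auto simp: directed_set_def)
  have refl: "le i i" if "i \<in> I" for i
    using that I by (auto simp: directed_set_def dest: reflp_onD)
  have trans: "le i k" if "le i j" "le j k" "i \<in> I" "j \<in> I" "k \<in> I" for i j k
    using that I by (auto simp: directed_set_def dest: transp_onD)
  have "\<forall>\<^sub>F (i, j) in ?F \<times>\<^sub>F ?F. p (x i - x j) < \<epsilon>" if p: "p \<in> M" "0 < \<epsilon>" for p \<epsilon>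
  proof -
    \<comment> \<open>Subtracting from a fixed \<open>x i0\<close> turns decrease into increase and
      supplies the order bound \<open>x i0\<close>.\<close>
    let ?D = "(\<lambda>i. x i0 - x i) ` {i\<in>I. le i0 i}"
    have "\<exists>d\<in>?D. \<forall>e\<in>?D. d \<le> e \<longrightarrow> p (e - d) < \<epsilon> / 2"
    proof (rule pre_lebesgue_set[OF assms(2) _ _ p(1)])
      show "?D \<noteq> {}" using i0 refl by blast
      show "0 \<le> d \<and> d \<le> x i0" if "d \<in> ?D" for d using that dec i0 nonneg by auto
    qed (use p in simp)
    then obtain i where i: "i \<in> I" "le i0 i"
      and small: "\<And>j. j \<in> I \<Longrightarrow> le i0 j \<Longrightarrow> x j \<le> x i \<Longrightarrow> p (x i - x j) < \<epsilon> / 2" by auto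
    \<comment> \<open>\<open>x j\<close> and \<open>x k\<close> need not be comparable, but both lie
      below \<open>x i\<close>, so the estimate goes through \<open>x i\<close>.\<close>
    have "p (x j - x k) < \<epsilon>" if j: "j \<in> I" "le i j" and k: "k \<in> I" "le i k" for j k
    proof -
      have 1: "p (x i - x j) < \<epsilon> / 2" "p (x i - x k) < \<epsilon> / 2"
        using small trans[OF i(2) _ i0 i(1)] i(1) j k dec by simp_all
      have "p (x j - x k) = p ((x j - x i) + (x i - x k))" by simp
      also have "\<dots> \<le> p (x j - x i) + p (x i - x k)" by (rule triangle[OF p(1)])
      also have "p (x j - x i) = p (x i - x j)" using abs_eq[OF p(1)] by (metis abs_minus_commute)
      finally show ?thesis using 1 by simp
    qed
    moreover have "eventually (\<lambda>j. j \<in> I \<and> le i j) ?F"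
      using i by (auto simp: eventually_net_filter[OF I])
    ultimately show ?thesis unfolding eventually_prod_same by blast
  qed
  then obtain l where l: "m_converges M x l ?F"
    using m_complete_limit[OF assms(1) net_filter_neq_bot[OF I], of x] by blast
  \<comment> \<open>Regarded as a \<open>um\<close>-limit, \<open>l\<close> inherits the order
    bounds of the net, which force it to be the infimum 0.\<close>
  note lim = m_converges_imp_um_converges[OF l] net_filter_neq_bot[OF I]
  have "l \<le> x i" if "i \<in> I" for i
    by (rule um_limit_le[OF lim]) (use that dec in \<open>auto simp: eventually_net_filter[OF I]\<close>)
  then have "l \<le> 0" by (rule greatest)
  moreover have "0 \<le> l"
    by (rule um_limit_ge[OF lim]) (use i0 nonneg in \<open>auto simp: eventually_net_filter[OF I]\<close>)
  ultimately show "m_converges M x 0 ?F" using l by simp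
qed

section \<open>From \<open>um\<close>-completeness to the Levi property\<close>

text \<open>Truncation at \<open>\<bar>x\<bar>\<close> itself gives \<open>\<bar>x\<bar> \<le> inf
  \<bar>v\<bar> \<bar>x\<bar> + \<bar>x + v\<bar>\<close>. Hence if \<open>p x\<close> exceeds
  \<open>C p\<close>, so does \<open>p (x + v)\<close> for every \<open>v\<close> in a suitable
  \<open>um\<close>-neighbourhood of zero.\<close>

lemma um_closed_seminorm_balls: "um_closed M {x. \<forall>p\<in>M. p x \<le> C p}"
proof -
  let ?A = "{x. \<forall>p\<in>M. p x \<le> C p}"
  have "openin (um_topology M) (- ?A)"
    unfolding openin_um_topology
  proof
    fix x assume "x \<in> - ?A"
    then obtain p where p: "p \<in> M" "C p < p x" by (auto simp: not_le)
    let ?V = "{v. p (inf \<bar>v\<bar> \<bar>x\<bar>) < p x - C p}"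
    have "x + v \<in> - ?A" if v: "v \<in> ?V" for v
    proof
      assume "x + v \<in> ?A"
      then have le: "p (x + v) \<le> C p" using p(1) by simp
      have "\<bar>x\<bar> = inf \<bar>- v + (x + v)\<bar> \<bar>x\<bar>" by simp
      also have "\<dots> \<le> inf \<bar>- v\<bar> \<bar>x\<bar> + inf \<bar>x + v\<bar> \<bar>x\<bar>" by (rule inf_abs_triangle) simp
      also have "\<dots> \<le> inf \<bar>v\<bar> \<bar>x\<bar> + \<bar>x + v\<bar>" by (intro add_mono) simp_all
      finally have "p \<bar>x\<bar> \<le> p (inf \<bar>v\<bar> \<bar>x\<bar> + \<bar>x + v\<bar>)"
        by (intro mono p(1)) (auto intro: order_trans[OF _ abs_ge_self])
      also have "\<dots> \<le> p (inf \<bar>v\<bar> \<bar>x\<bar>) + p (x + v)"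
        using triangle[OF p(1), of "inf \<bar>v\<bar> \<bar>x\<bar>" "\<bar>x + v\<bar>"] by (simp add: abs_eq p(1))
      finally show False using v le by (simp add: abs_eq p(1))
    qed
    then have "(+) x ` ?V \<subseteq> - ?A" by blast
    moreover have "?V \<in> um_base M" using p by (intro um_baseI) simp_all
    ultimately show "\<exists>V\<in>um_base M. (+) x ` V \<subseteq> - ?A" by blast
  qed
  moreover have "topspace (um_topology M) = UNIV"
    unfolding um_topology_def by (rule zero_base.topspace_zero_base_topology[OF um_zero_base])
  ultimately show ?thesis by (simp add: um_closed_def closedin_def Compl_eq_Diff_UNIV)
qed

lemma um_cauchy_bounded_increasing_net:
  assumes pre: "pre_lebesgue_property M" and I: "directed_set I le"
    and x: "monotone_on I le (\<le>) x" "\<forall>i\<in>I. 0 \<le> x i" and bdd: "m_bounded M (x ` I)"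
  shows "zero_base_cauchy (um_base M) (filtermap x (net_filter I le))"
  unfolding zero_base_cauchy_um_iff
proof (intro allI impI ballI)
  fix u :: 'a and p and \<epsilon> :: real assume *: "0 \<le> u" "p \<in> M" "0 < \<epsilon>"
  let ?F = "filtermap x (net_filter I le)"
  obtain C where C: "\<And>i. i \<in> I \<Longrightarrow> p (x i) \<le> C"
    using bdd *(2) unfolding m_bounded_def bdd_above_def by blast
  obtain k where k: "1 \<le> k" "4 * C < \<epsilon> * k"
  proof
    \<comment> \<open>The truncation inequality requires \<open>1 \<le> k\<close>; the other entry
      makes its error term at most \<open>\<epsilon> / 4\<close> in \<open>p\<close>.\<close>
    let ?k = "max 1 (4 * C / \<epsilon> + 1)"
    show "1 \<le> ?k" by simp
    have "4 * C / \<epsilon> < ?k" by simp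
    then show "4 * C < \<epsilon> * ?k" using *(3) by (simp add: pos_divide_less_eq mult.commute)
  qed
  let ?D = "(\<lambda>i. inf (x i) (k *\<^sub>R u)) ` I"
  have ku: "0 \<le> k *\<^sub>R u" using k * by (simp add: scaleR_nonneg_nonneg)
  \<comment> \<open>Unlike the net, its truncations lie in the order interval from 0 to
    \<open>k *\<^sub>R u\<close>, so the pre-Lebesgue property applies to them.\<close>
  have "\<exists>d\<in>?D. \<forall>e\<in>?D. d \<le> e \<longrightarrow> p (e - d) < \<epsilon> / 4"
    by (rule pre_lebesgue_set[OF pre, where a = "k *\<^sub>R u"])
      (use I x ku * in \<open>auto simp: directed_set_def\<close>)
  then obtain i where i: "i \<in> I" and small: "\<And>j. j \<in> I \<Longrightarrow>
      inf (x i) (k *\<^sub>R u) \<le> inf (x j) (k *\<^sub>R u) \<Longrightarrow>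
      p (inf (x j) (k *\<^sub>R u) - inf (x i) (k *\<^sub>R u)) < \<epsilon> / 4" by auto
  have tail: "p (inf \<bar>x j - x i\<bar> u) < \<epsilon> / 2" if j: "j \<in> I" "le i j" for j
  proof -
    have ij: "0 \<le> x i" "x i \<le> x j" using x i j by (auto simp: monotone_on_def)
    have "inf \<bar>x j - x i\<bar> u = inf (x j - x i) u" using ij by (simp add: abs_of_nonneg)
    also have "\<dots> \<le> (inf (x j) (k *\<^sub>R u) - inf (x i) (k *\<^sub>R u)) + (1 / k) *\<^sub>R x i"
      by (rule inf_diff_le_truncation[OF ij(1) k(1)])
    finally have "p (inf \<bar>x j - x i\<bar> u) \<le>
        p ((inf (x j) (k *\<^sub>R u) - inf (x i) (k *\<^sub>R u)) + (1 / k) *\<^sub>R x i)"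
      using * by (intro mono) (auto intro: order_trans[OF _ abs_ge_self])
    also have "\<dots> \<le> p (inf (x j) (k *\<^sub>R u) - inf (x i) (k *\<^sub>R u)) + p ((1 / k) *\<^sub>R x i)"
      by (rule triangle[OF *(2)])
    also have "p (inf (x j) (k *\<^sub>R u) - inf (x i) (k *\<^sub>R u)) < \<epsilon> / 4"
      using j ij by (intro small inf_mono) simp_all
    also have "p ((1 / k) *\<^sub>R x i) \<le> \<epsilon> / 4"
      using k C[OF i] by (simp add: scale[OF *(2)] field_simps)
    finally show ?thesis by simp
  qed
  have "p (inf \<bar>x j - x k\<bar> u) < \<epsilon>" if j: "j \<in> I" "le i j" and k: "k \<in> I" "le i k" for j k
  proof -
    have "inf \<bar>x j - x k\<bar> u = inf \<bar>(x j - x i) + (x i - x k)\<bar> u" by simp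
    also have "\<dots> \<le> inf \<bar>x j - x i\<bar> u + inf \<bar>x i - x k\<bar> u" by (rule inf_abs_triangle[OF *(1)])
    also have "\<bar>x i - x k\<bar> = \<bar>x k - x i\<bar>" by (rule abs_minus_commute)
    finally have "p (inf \<bar>x j - x k\<bar> u) \<le> p (inf \<bar>x j - x i\<bar> u + inf \<bar>x k - x i\<bar> u)"
      using * by (intro mono) (auto intro: order_trans[OF _ abs_ge_self])
    also have "\<dots> \<le> p (inf \<bar>x j - x i\<bar> u) + p (inf \<bar>x k - x i\<bar> u)" by (rule triangle[OF *(2)])
    finally show ?thesis using tail[OF j] tail[OF k] by simp
  qed
  then have "\<And>a b. a \<in> x ` {j\<in>I. le i j} \<Longrightarrow> b \<in> x ` {j\<in>I. le i j} \<Longrightarrow> p (inf \<bar>a - b\<bar> u) < \<epsilon>"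
    by blast
  moreover have "eventually (\<lambda>a. a \<in> x ` {j\<in>I. le i j}) ?F"
    using i by (auto simp: eventually_net_filter[OF I] eventually_filtermap)
  ultimately show "\<forall>\<^sub>F (a, b) in ?F \<times>\<^sub>F ?F. p (inf \<bar>a - b\<bar> u) < \<epsilon>"
    unfolding eventually_prod_same by blast
qed

lemma um_complete_imp_levi:
  assumes pre: "pre_lebesgue_property M"
    and complete: "\<And>A. m_bounded M A \<Longrightarrow> um_closed M A \<Longrightarrow> um_complete M A"
  shows "levi_property M"
  unfolding levi_property_def
proof (intro allI impI)
  fix I :: "'a set" and le and x :: "'a \<Rightarrow> 'a"
  assume I: "directed_set I le" and x: "monotone_on I le (\<le>) x" "\<forall>i\<in>I. 0 \<le> x i"
    and bdd: "m_bounded M (x ` I)"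
  let ?F = "net_filter I le"
  obtain C where C: "\<And>p i. p \<in> M \<Longrightarrow> i \<in> I \<Longrightarrow> p (x i) \<le> C p"
  proof
    show "p (x i) \<le> (SUP i\<in>I. p (x i))" if "p \<in> M" "i \<in> I" for p i
      using that bdd by (intro cSUP_upper) (auto simp: m_bounded_def image_image)
  qed
  \<comment> \<open>The radii are read off from the net, so \<open>?A\<close> contains all of it.
    Taking \<open>?A\<close> rather than the \<open>um\<close>-closure of the net makes
    \<open>m\<close>-boundedness immediate.\<close>
  let ?A = "{a. \<forall>p\<in>M. p a \<le> C p}"
  have "m_bounded M ?A" by (auto simp: m_bounded_def bdd_above_def)
  then have "um_complete M ?A" using um_closed_seminorm_balls by (rule complete)
  moreover have "filtermap x ?F \<le> principal ?A"
    using C I by (auto simp: le_principal eventually_filtermap eventually_net_filter[OF I] directed_set_def)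
  moreover have "filtermap x ?F \<noteq> bot" by (simp add: filtermap_bot_iff net_filter_neq_bot[OF I])
  ultimately obtain a where "limitin (um_topology M) (\<lambda>x. x) a (filtermap x ?F)"
    using um_cauchy_bounded_increasing_net[OF pre I x bdd]
    unfolding um_complete_def zero_base_complete_def um_topology_def by blast
  then have "um_converges M x a ?F"
    by (simp add: limitin_um_topology um_converges_iff eventually_filtermap)
  note lim = this net_filter_neq_bot[OF I]
  have "x i \<le> a" if "i \<in> I" for i
    by (rule um_limit_ge[OF lim])
      (use that x(1) in \<open>auto simp: eventually_net_filter[OF I] monotone_on_def\<close>)
  moreover have "a \<le> b" if "\<And>i. i \<in> I \<Longrightarrow> x i \<le> b" for b
    by (rule um_limit_le[OF lim])
      (use that I in \<open>auto simp: eventually_net_filter[OF I] directed_set_def\<close>)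
  ultimately have "isLub UNIV (x ` I) a"
    by (auto simp: isLub_def leastP_def isUb_def setle_def setge_def)
  then show "\<exists>a. net_increases_to I le x a" using x(1) by (auto simp: net_increases_to_def)
qed

section \<open>From the Levi property to \<open>um\<close>-completeness\<close>

text \<open>The Levi property concerns positive nets, hence the restriction to positive parts. Their
  truncations have \<open>m\<close>-limits, which increase with the truncation level and stay
  bounded; the supremum of these limits is the \<open>um\<close>-limit.\<close>

lemma levi_imp_um_convergent_pprt:
  assumes complete: "m_complete M" and levi: "levi_property M"
    and F: "F \<noteq> bot" "zero_base_cauchy (um_base M) F" "F \<le> principal A" and A: "m_bounded M A"
  shows "\<exists>l. um_converges M pprt l F"
proof -
  have "\<exists>l. m_converges M (\<lambda>x. inf (pprt x) u) l F" if u: "0 \<le> u" for u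
  proof (rule m_complete_limit[OF complete F(1)])
    fix p and \<epsilon> :: real assume p: "p \<in> M" "0 < \<epsilon>"
    have "\<forall>\<^sub>F (x, y) in F \<times>\<^sub>F F. p (inf \<bar>x - y\<bar> u) < \<epsilon>"
      using F(2) p u by (simp add: zero_base_cauchy_um_iff)
    moreover have "p (inf (pprt x) u - inf (pprt y) u) \<le> p (inf \<bar>x - y\<bar> u)" for x y
      using abs_inf_pprt_diff_le[OF u, of x y] u
      by (intro lattice_seminorm_mono[OF seminorm[OF p(1)]]) (simp add: abs_of_nonneg)
    ultimately show "\<forall>\<^sub>F (x, y) in F \<times>\<^sub>F F. p (inf (pprt x) u - inf (pprt y) u) < \<epsilon>"
      by (auto elim!: eventually_mono intro: le_less_trans)
  qed
  then obtain L where L: "\<And>u. 0 \<le> u \<Longrightarrow> m_converges M (\<lambda>x. inf (pprt x) u) (L u) F" by metis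
  note lim = m_converges_imp_um_converges[OF L]
  have Lpos: "0 \<le> L u" if "0 \<le> u" for u
    by (rule um_limit_ge[OF lim F(1)]) (simp_all add: that)
  have Lle: "L u \<le> u" if "0 \<le> u" for u
    by (rule um_limit_le[OF lim F(1)]) (simp_all add: that)
  have Lmono: "L u \<le> L v" if uv: "0 \<le> u" "u \<le> v" for u v
  proof -
    have v: "0 \<le> v" using uv by simp
    have "L u - L v \<le> 0"
      by (rule um_limit_le[OF um_converges_diff[OF lim[OF uv(1)] lim[OF v]] F(1)])
        (intro always_eventually allI, simp only: diff_le_0_iff_le inf_mono order_refl uv)
    then show ?thesis by simp
  qed
  \<comment> \<open>The truncation levels themselves index the net \<open>L\<close>, so its index
    set is a subset of the space, as \<open>levi_property\<close> demands.\<close>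
  define P where "P = {u :: 'a. 0 \<le> u}"
  have P: "directed_set P (\<le>)"
    unfolding directed_set_def
  proof (intro conjI ballI)
    show "P \<noteq> {}" by (auto simp: P_def)
    show "reflp_on P (\<le>)" "transp_on P (\<le>)" by (auto intro!: reflp_onI transp_onI)
    show "\<exists>w\<in>P. u \<le> w \<and> v \<le> w" if "u \<in> P" "v \<in> P" for u v
      using that by (intro bexI[of _ "sup u v"]) (auto simp: P_def le_supI1)
  qed
  have "m_bounded M (L ` P)"
    unfolding m_bounded_def
  proof
    fix p assume p: "p \<in> M"
    obtain C where C: "\<And>x. x \<in> A \<Longrightarrow> p x \<le> C"
      using A p unfolding m_bounded_def bdd_above_def by blast
    \<comment> \<open>\<open>L u\<close> is within \<open>p\<close>-distance 1 of the truncation of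
      some element of \<open>A\<close>.\<close>
    have "p (L u) \<le> C + 1" if u: "0 \<le> u" for u
    proof -
      have "\<forall>\<^sub>F x in F. p (inf (pprt x) u - L u) < 1"
        using L[OF u] p by (simp add: m_converges_iff[OF multi_normed_vector_lattice_axioms])
      moreover have "\<forall>\<^sub>F x in F. x \<in> A" using F(3) by (simp add: le_principal)
      ultimately have "\<forall>\<^sub>F x in F. p (L u) \<le> C + 1"
      proof eventually_elim
        case (elim x)
        have "p (L u) = p ((L u - inf (pprt x) u) + inf (pprt x) u)" by (simp only: diff_add_cancel)
        also have "\<dots> \<le> p (L u - inf (pprt x) u) + p (inf (pprt x) u)" by (rule triangle[OF p])
        also have "p (L u - inf (pprt x) u) = p (inf (pprt x) u - L u)"
          using abs_eq[OF p] by (metis abs_minus_commute)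
        also have "p (inf (pprt x) u) \<le> p x"
        proof (rule mono[OF p])
          have "inf (pprt x) u \<le> pprt x" by simp
          also have "\<dots> \<le> \<bar>x\<bar>" by (simp add: pprt_def abs_ge_self)
          finally show "inf (pprt x) u \<le> \<bar>x\<bar>" .
        qed (simp add: u)
        also have "p x \<le> C" using elim by (simp add: C)
        finally show ?case using elim by simp
      qed
      then show ?thesis using F(1) by (simp add: eventually_const)
    qed
    then show "bdd_above (p ` L ` P)" by (auto simp: bdd_above_def P_def)
  qed
  moreover have "monotone_on P (\<le>) (\<le>) L" using Lmono by (auto simp: monotone_on_def P_def)
  moreover have "\<forall>u\<in>P. 0 \<le> L u" using Lpos by (simp add: P_def)
  ultimately obtain l where "net_increases_to P (\<le>) L l"
    using levi P unfolding levi_property_def by blast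
  then have ub: "\<And>u. 0 \<le> u \<Longrightarrow> L u \<le> l" and least: "\<And>b. (\<And>u. 0 \<le> u \<Longrightarrow> L u \<le> b) \<Longrightarrow> l \<le> b"
    by (auto simp: net_increases_to_def isLub_def leastP_def isUb_def setle_def setge_def P_def)
  have Linf: "inf l w = L w" if w: "0 \<le> w" for w
  proof (rule antisym)
    show "L w \<le> inf l w" using ub Lle w by simp
    \<comment> \<open>If lowering \<open>l\<close> by the excess \<open>inf l w - L w\<close> still
      leaves an upper bound of \<open>L\<close>, then minimality of \<open>l\<close> makes the
      excess nonpositive.\<close>
    have "l \<le> l - (inf l w - L w)"
    proof (rule least)
      fix u :: 'a assume u: "0 \<le> u"
      \<comment> \<open>Above \<open>u\<close>, this level gives \<open>L u \<le> L ?v\<close>;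
        above \<open>w\<close>, it lets truncation at \<open>w\<close> factor through truncation at
        \<open>?v\<close>, so that \<open>inf (L ?v) w = L w\<close> by uniqueness of
        limits.\<close>
      let ?v = "sup u w"
      have v: "0 \<le> ?v" "u \<le> ?v" using u by (simp_all add: le_supI1)
      have "pprt (inf (pprt x) ?v) = inf (pprt x) ?v" for x using v(1) by simp
      moreover have "inf (inf (pprt x) ?v) w = inf (pprt x) w" for x
        by (simp add: inf_assoc inf_absorb2)
      ultimately have "m_converges M (\<lambda>x. inf (pprt x) w) (inf (L ?v) w) F"
        using m_converges_inf_pprt[OF L[OF v(1)] w] Lpos[OF v(1)] by simp
      then have "inf (L ?v) w = L w"
        by (intro um_limit_unique[OF _ lim[OF w] F(1)] m_converges_imp_um_converges)
      moreover have "inf l w \<le> inf (L ?v) w + (l - L ?v)"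
        using ub[OF v(1)] by (simp add: add_inf_distrib_right add_increasing2 le_infI2)
      ultimately have "inf l w \<le> L w + (l - L ?v)" by simp
      then have "L ?v \<le> l - (inf l w - L w)" by (simp add: algebra_simps del: diff_inf_eq_sup)
      then show "L u \<le> l - (inf l w - L w)" using Lmono[OF u v(2)] by (rule order_trans[rotated])
    qed
    then show "inf l w \<le> L w" by (simp only: le_diff_eq add_le_same_cancel1 diff_le_0_iff_le)
  qed
  have "0 \<le> l" using ub[of 0] Lpos[of 0] by simp
  have "um_converges M pprt l F"
    unfolding um_converges_iff
  proof (intro allI impI ballI)
    fix u :: 'a and p and \<epsilon> :: real assume *: "0 \<le> u" "p \<in> M" "0 < \<epsilon>"
    \<comment> \<open>The level \<open>l + u\<close> is high enough to leave \<open>l\<close>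
      untouched, and subtracting \<open>l\<close> from a truncation at this level gives a truncation
      of the difference at \<open>u\<close>.\<close>
    have lu: "0 \<le> l + u" using \<open>0 \<le> l\<close> * by simp
    have Llu: "L (l + u) = l" using Linf[OF lu] * by (simp add: inf_absorb1)
    have "\<forall>\<^sub>F x in F. p (inf (pprt x) (l + u) - l) < \<epsilon>"
      using L[OF lu] * Llu by (simp add: m_converges_iff[OF multi_normed_vector_lattice_axioms])
    then show "\<forall>\<^sub>F x in F. p (inf \<bar>pprt x - l\<bar> u) < \<epsilon>"
    proof eventually_elim
      case (elim x)
      have "inf (pprt x) (l + u) - l = inf (pprt x - l) u"
        by (simp add: diff_conv_add_uminus add_inf_distrib_right del: add_uminus_conv_diff)
      then have "p (inf \<bar>pprt x - l\<bar> u) \<le> p (inf (pprt x) (l + u) - l)"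
        using * inf_abs_le_abs_inf[of _ u] by (intro mono) simp_all
      then show ?case using elim by simp
    qed
  qed
  then show ?thesis by blast
qed

text \<open>Every \<open>x\<close> is \<open>pprt x - pprt (- x)\<close>, and negation preserves
  boundedness and the \<open>um\<close>-Cauchy condition. So the result on positive parts applies to
  \<open>F\<close> and to its image under negation, and \<open>um\<close>-closedness places the
  difference of the two limits in \<open>A\<close>.\<close>

lemma levi_imp_um_complete:
  assumes complete: "m_complete M" and levi: "levi_property M"
    and A: "m_bounded M A" "um_closed M A"
  shows "um_complete M A"
  unfolding um_complete_def zero_base_complete_def
proof (intro allI impI)
  fix F assume F: "F \<le> principal A" "F \<noteq> bot" "zero_base_cauchy (um_base M) F"
  obtain l where l: "um_converges M pprt l F"
    using levi_imp_um_convergent_pprt[OF complete levi F(2,3,1) A(1)] by blast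
  let ?G = "filtermap uminus F"
  have "\<exists>m. um_converges M pprt m ?G"
  proof (rule levi_imp_um_convergent_pprt[OF complete levi])
    show "?G \<noteq> bot" using F(2) by (simp add: filtermap_bot_iff)
    have "\<bar>- x - - y\<bar> = \<bar>x - y\<bar>" for x y :: 'a by (simp add: abs_minus_commute)
    then show "zero_base_cauchy (um_base M) ?G"
      using F(3) unfolding zero_base_cauchy_um_iff prod_filtermap1 prod_filtermap2
      by (simp add: eventually_filtermap case_prod_unfold)
    show "?G \<le> principal (uminus ` A)"
      using F(1) by (auto simp: le_principal eventually_filtermap elim: eventually_mono)
    show "m_bounded M (uminus ` A)"
      unfolding m_bounded_def
    proof
      fix p assume p: "p \<in> M"
      have "p (- x) = p x" for x using abs_eq[OF p] by (metis abs_minus_cancel)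
      then show "bdd_above (p ` uminus ` A)" using A(1) p by (simp add: m_bounded_def image_image)
    qed
  qed
  then obtain m where "um_converges M pprt m ?G" by blast
  then have "um_converges M (\<lambda>x. pprt (- x)) m F"
    by (simp add: um_converges_iff eventually_filtermap)
  from um_converges_diff[OF l this] have "um_converges M (\<lambda>x. x) (l - m) F"
  proof -
    have "pprt x - pprt (- x) = x" for x :: 'a using prts[of x] by (simp add: pprt_neg)
    with \<open>um_converges M (\<lambda>i. pprt i - pprt (- i)) (l - m) F\<close> show ?thesis by simp
  qed
  then have lim: "limitin (um_topology M) (\<lambda>x. x) (l - m) F" by (simp add: limitin_um_topology)
  have "l - m \<in> A"
    using limitin_closedin[OF lim] A(2) F(1,2) by (simp add: um_closed_def le_principal)
  then show "\<exists>a\<in>A. limitin (zero_base_topology (um_base M)) (\<lambda>x. x) a F"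
    using lim by (auto simp: um_topology_def)
qed

end

theorem theorem2:
  fixes M :: "('a::vector_lattice \<Rightarrow> real) set"
  assumes "multi_normed_vector_lattice M"
    and "m_complete M"
    and "pre_lebesgue_property M"
  shows "lebesgue_property M \<and> levi_property M \<longleftrightarrow>
    (\<forall>A. m_bounded M A \<longrightarrow> um_closed M A \<longrightarrow> um_complete M A)"
proof -
  interpret multi_normed_vector_lattice M by fact
  show ?thesis
    using assms(2,3) m_complete_pre_lebesgue_imp_lebesgue um_complete_imp_levi levi_imp_um_complete
    by blast
qed

end
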